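(* Let $n,q,m$ be positive integers and $p=q+m$. Let $\boldsymbol{X}=[\boldsymbol{W},\boldsymbol{T}]\in\mathbb{R}^{n\times p}$ be a fixed (deterministic) matrix with $\boldsymbol{W}\in\mathbb{R}^{n\times q}$, $\mathrm{rank}(\boldsymbol{W})=n<q$, and $\boldsymbol{T}\in\mathbb{R}^{n\times m}$, $\mathrm{rank}(\boldsymbol{T})=m<n$. For $i\in\{1,\dots,n\}$ let $$\widetilde{\boldsymbol{W}}_i=\left(\boldsymbol{I}_q-\frac{\boldsymbol{W}^\dagger\boldsymbol{e}_i\boldsymbol{e}_i^\top(\boldsymbol{W}^{\dagger})^\top}{\boldsymbol{e}_i^\top\boldsymbol{G}_{\boldsymbol{W}}\boldsymbol{e}_i}\right)\boldsymbol{W}^\dagger,\qquad \boldsymbol{H}_i=\boldsymbol{T}(\widetilde{\boldsymbol{W}}_i\boldsymbol{T})^\dagger\widetilde{\boldsymbol{W}}_i .$$ For a response vector $\boldsymbol{y}\in\mathbb{R}^n$ let $\widetilde{\boldsymbol{\varepsilon}}_{\mathrm{partial}}\in\mathbb{R}^n$ be the vector with $i$-th entry $$\widetilde{\varepsilon}_i=\boldsymbol{e}_i^\top[\mathrm{diag}(\boldsymbol{G}_{\boldsymbol{W}})]^{-1}\boldsymbol{G}_{\boldsymbol{W}}(\boldsymbol{I}_n-\boldsymbol{H}_i)\boldsymbol{y},$$ and define $$\widehat{\sigma}^2_{\mathrm{partial}}=\frac{\|\widetilde{\boldsymbol{\varepsilon}}_{\mathrm{partial}}\|_2^2}{\sum_{i=1}^n\left\|\boldsymbol{e}_i^\top[\mathrm{diag}(\boldsymbol{G}_{\boldsymbol{W}})]^{-1}\boldsymbol{G}_{\boldsymbol{W}}(\boldsymbol{I}_n-\boldsymbol{H}_i)\right\|_2^2}.$$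 Suppose $\boldsymbol{y}=\boldsymbol{X}\boldsymbol{\beta}+\boldsymbol{\varepsilon}$, where $\boldsymbol{\beta}\in\mathbb{R}^p$ is deterministic and $\boldsymbol{\varepsilon}$ is a random vector in $\mathbb{R}^n$ with $\mathbb{E}[\boldsymbol{\varepsilon}]=\boldsymbol{0}$ and $\mathrm{Cov}(\boldsymbol{\varepsilon})=\sigma^2\boldsymbol{I}_n$. Then $$\mathbb{E}[\widehat{\sigma}^2_{\mathrm{partial}}]=\sigma^2+\frac{\|\mathbb{E}[\widetilde{\boldsymbol{\varepsilon}}_{\mathrm{partial}}]\|_2^2}{\sum_{i=1}^n\left\|\boldsymbol{e}_i^\top[\mathrm{diag}(\boldsymbol{G}_{\boldsymbol{W}})]^{-1}\boldsymbol{G}_{\boldsymbol{W}}(\boldsymbol{I}_n-\boldsymbol{H}_i)\right\|_2^2}.$$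
   Context: Notation: $\boldsymbol{M}^\dagger$ is the Moore–Penrose pseudoinverse of $\boldsymbol{M}$; $\boldsymbol{G}_{\boldsymbol{M}}=(\boldsymbol{M}\boldsymbol{M}^\top)^\dagger$. For a square matrix $\boldsymbol{M}\in\mathbb{R}^{n\times n}$, $\mathrm{diag}(\boldsymbol{M})=\sum_{j=1}^nM_{jj}\boldsymbol{e}_j\boldsymbol{e}_j^\top$ is the diagonal matrix with the same diagonal. $\boldsymbol{e}_i$ is the $i$-th standard basis vector of $\mathbb{R}^n$. (The quantity $\widetilde{\varepsilon}_i$ is the leave-$i$-out prediction residual of the least squares interpolator of $\boldsymbol{y}$ on $[\boldsymbol{W},\boldsymbol{T}]$ in which only the coefficients of $\boldsymbol{W}$ are penalized; only the displayed formula is needed here.) *)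

theory Defs
  imports "HOL-Probability.Probability"
begin

text \<open>The four Penrose conditions.\<close>

definition is_pinv :: "real^'c^'r \<Rightarrow> real^'r^'c \<Rightarrow> bool" where
  "is_pinv A B \<longleftrightarrow>
     A ** B ** A = A \<and> B ** A ** B = B \<and>
     transpose (A ** B) = A ** B \<and> transpose (B ** A) = B ** A"

lemma is_pinv_unique:
  assumes B: "is_pinv A B" and C: "is_pinv A C"
  shows "B = C"
proof -
  have "A ** B = (A ** C) ** (A ** B)"
    using C by (simp add: is_pinv_def matrix_mul_assoc)
  also have "\<dots> = transpose (A ** C) ** transpose (A ** B)"
    using B C by (simp add: is_pinv_def)
  also have "\<dots> = transpose ((A ** B) ** (A ** C))"
    by (simp only: matrix_transpose_mul)
  also have "\<dots> = A ** C"
    using B C by (simp add: is_pinv_def matrix_mul_assoc)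
  finally have AB: "A ** B = A ** C" .
  have "B ** A = (B ** A) ** (C ** A)"
    using C by (metis is_pinv_def matrix_mul_assoc)
  also have "\<dots> = transpose (B ** A) ** transpose (C ** A)"
    using B C by (simp add: is_pinv_def)
  also have "\<dots> = transpose ((C ** A) ** (B ** A))"
    by (simp only: matrix_transpose_mul)
  also have "\<dots> = C ** A"
    using B C by (metis is_pinv_def matrix_mul_assoc)
  finally have BA: "B ** A = C ** A" .
  have "B = B ** A ** B" using B by (simp add: is_pinv_def)
  also have "\<dots> = C ** A ** C" by (metis AB BA matrix_mul_assoc)
  also have "\<dots> = C" using C by (simp add: is_pinv_def)
  finally show ?thesis .
qed

lemma normal_equation_solvable:
  fixes A :: "real^'c^'r"
  shows "\<exists>X. transpose A ** A ** X = transpose A"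
proof -
  have "\<exists>x. (transpose A ** A) *v x = transpose A *v b" for b
  proof -
    have sub: "subspace (range ((*v) A))"
      by (intro linear_subspace_image matrix_vector_mul_linear subspace_UNIV)
    obtain p r where p: "p \<in> span (range ((*v) A))"
      and r: "\<And>w. w \<in> span (range ((*v) A)) \<Longrightarrow> orthogonal r w" and b: "b = p + r"
      using orthogonal_subspace_decomp_exists by metis
    obtain x where x: "p = A *v x"
      using p sub by (auto simp: span_eq_iff[THEN iffD2])
    have "(transpose A *v r) \<bullet> w = 0" for w
      using r[OF span_base, of "A *v w"]
      by (simp add: orthogonal_def dot_lmul_matrix flip: vector_transpose_matrix)
    then have "transpose A *v r = 0"
      by (metis inner_eq_zero_iff)
    then have "(transpose A ** A) *v x = transpose A *v b"
      by (simp add: b x matrix_vector_right_distrib matrix_vector_mul_assoc)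
    then show ?thesis ..
  qed
  then obtain x where x: "\<And>b. (transpose A ** A) *v x b = transpose A *v b"
    by metis
  let ?X = "(\<chi> i j. x (axis j 1) $ i) :: real^'r^'c"
  have "column j (transpose A ** A ** ?X) = column j (transpose A)" for j
  proof -
    have "column j ?X = x (axis j 1)"
      by (simp add: column_def vec_eq_iff)
    then show ?thesis
      using x[of "axis j 1"]
      by (metis matrix_vector_mul_assoc matrix_vector_mult_basis)
  qed
  then have "transpose A ** A ** ?X = transpose A"
    by (simp add: column_def vec_eq_iff)
  then show ?thesis ..
qed

lemma symmetric_inner_inverse_exists:
  fixes A :: "real^'c^'r"
  shows "\<exists>X. A ** X ** A = A \<and> transpose (A ** X) = A ** X"
proof -
  obtain X where X: "transpose A ** A ** X = transpose A"
    using normal_equation_solvable by blast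
  have eq: "transpose (A ** X) = transpose (A ** X) ** (A ** X)"
    by (metis X matrix_mul_assoc matrix_transpose_mul)
  then have sym: "transpose (A ** X) = A ** X"
    by (metis matrix_transpose_mul transpose_transpose)
  have "A = transpose (transpose A ** (A ** X))"
    using X by (simp add: matrix_mul_assoc transpose_transpose)
  also have "\<dots> = A ** X ** A"
    using sym by (metis matrix_transpose_mul transpose_transpose)
  finally show ?thesis using sym by metis
qed

lemma is_pinv_exists: "\<exists>B. is_pinv A B"
proof -
  obtain X where X: "A ** X ** A = A" "transpose (A ** X) = A ** X"
    using symmetric_inner_inverse_exists by blast
  obtain Z where Z: "transpose A ** Z ** transpose A = transpose A"
      "transpose (transpose A ** Z) = transpose A ** Z"
    using symmetric_inner_inverse_exists by blast
  define Y where "Y = transpose Z"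
  have Y: "A ** Y ** A = A" "transpose (Y ** A) = Y ** A"
    using Z by (metis Y_def matrix_mul_assoc matrix_transpose_mul transpose_transpose)+
  have e1: "A ** (Y ** A ** X) = A ** X" by (simp add: Y(1) matrix_mul_assoc)
  have e2: "Y ** A ** X ** A = Y ** A" by (metis X(1) matrix_mul_assoc)
  have "is_pinv A (Y ** A ** X)"
    unfolding is_pinv_def e1 e2 using X Y by (metis matrix_mul_assoc)
  then show ?thesis ..
qed

definition pinv :: "real^'c^'r \<Rightarrow> real^'r^'c" where
  "pinv A = (THE B. is_pinv A B)"

lemma is_pinv_pinv: "is_pinv A (pinv A)"
  unfolding pinv_def using is_pinv_exists is_pinv_unique by (metis theI)

definition gram_pinv :: "real^'q^'n \<Rightarrow> real^'n^'n" where
  "gram_pinv A = pinv (A ** transpose A)"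

definition diag_part :: "real^'n^'n \<Rightarrow> real^'n^'n" where
  "diag_part A = (\<chi> i j. if i = j then A $ i $ i else 0)"

definition outer :: "real^'r \<Rightarrow> real^'c \<Rightarrow> real^'c^'r" where
  "outer u v = (\<chi> i j. u $ i * v $ j)"

definition hcat :: "real^'q^'n \<Rightarrow> real^'m^'n \<Rightarrow> real^('q + 'm)^'n" where
  "hcat A B = (\<chi> i k. case k of Inl j \<Rightarrow> A $ i $ j | Inr l \<Rightarrow> B $ i $ l)"

definition W_tilde :: "real^'q^'n \<Rightarrow> 'n \<Rightarrow> real^'n^'q" where
  "W_tilde W i =
     (mat 1 - (1 / (axis i 1 \<bullet> (gram_pinv W *v axis i 1))) *\<^sub>R
        (pinv W ** outer (axis i 1) (axis i 1) ** transpose (pinv W))) ** pinv W"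

definition H_loo :: "real^'q^'n \<Rightarrow> real^'m^'n \<Rightarrow> 'n \<Rightarrow> real^'n^'n" where
  "H_loo W T i = T ** pinv (W_tilde W i ** T) ** W_tilde W i"

text \<open>
  \<open>partial_row W T i\<close> is the row vector
  \<open>e\<^sub>i\<^sup>T [diag(G\<^sub>W)]\<^sup>-\<^sup>1 G\<^sub>W (I - H\<^sub>i)\<close>.  When \<open>W\<close> has
  full row rank, \<open>G\<^sub>W\<close> is positive definite, so \<open>matrix_inv\<close> here and the division in \<open>W_tilde\<close>
  are meaningful; moreover \<open>H\<^sub>i e\<^sub>i = 0\<close>, so entry \<open>i\<close> of this row is 1 and the denominator in
  \<open>sigma2_partial\<close> is positive.
\<close>

definition partial_row :: "real^'q^'n \<Rightarrow> real^'m^'n \<Rightarrow> 'n \<Rightarrow> real^'n" where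
  "partial_row W T i =
     axis i 1 v* (matrix_inv (diag_part (gram_pinv W)) ** gram_pinv W ** (mat 1 - H_loo W T i))"

definition eps_partial :: "real^'q^'n \<Rightarrow> real^'m^'n \<Rightarrow> real^'n \<Rightarrow> real^'n" where
  "eps_partial W T y = (\<chi> i. partial_row W T i \<bullet> y)"

definition partial_norm_sum :: "real^'q^'n \<Rightarrow> real^'m^'n \<Rightarrow> real" where
  "partial_norm_sum W T = (\<Sum>i\<in>UNIV. (norm (partial_row W T i))\<^sup>2)"

definition sigma2_partial :: "real^'q^'n \<Rightarrow> real^'m^'n \<Rightarrow> real^'n \<Rightarrow> real" where
  "sigma2_partial W T y = (norm (eps_partial W T y))\<^sup>2 / partial_norm_sum W T"

text \<open>Meaningful for square-integrable \<open>Y\<close>, as Bochner integrals default to 0.\<close>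

definition cov_matrix :: "'w measure \<Rightarrow> ('w \<Rightarrow> real^'n) \<Rightarrow> real^'n^'n" where
  "cov_matrix M Y = (\<chi> i j.
     LINT \<omega>|M. (Y \<omega> $ i - (LINT \<omega>'|M. Y \<omega>') $ i) * (Y \<omega> $ j - (LINT \<omega>'|M. Y \<omega>') $ j))"

end

theory Submission
  imports Defs
begin

text \<open>
  The row vector \<open>r\<^sub>i\<close> defining the \<open>i\<close>-th residual has \<open>i\<close>-th entry 1, because
  \<open>W_tilde W i\<close> annihilates \<open>e\<^sub>i\<close> and hence \<open>H\<^sub>i e\<^sub>i = 0\<close>; so the denominator is positive.
  The rest is the bias-variance identity
  \<open>E (a + r \<bullet> \<epsilon>)\<^sup>2 = a\<^sup>2 + \<sigma>\<^sup>2 |r|\<^sup>2\<close> summed over the rows.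
\<close>

text \<open>Full row rank yields some right inverse \<open>B\<close>; multiplying the Penrose
  identity for \<open>W ** pinv W ** W\<close> by \<open>B\<close> on the right cancels the last
  factor.\<close>

lemma pinv_right_inverse:
  fixes W :: "real^'q^'n"
  assumes "rank W = CARD('n)"
  shows "W ** pinv W = mat 1"
proof -
  obtain B where B: "W ** B = mat 1"
    using assms full_rank_surjective matrix_right_invertible_surjective by metis
  have "W ** pinv W = (W ** pinv W ** W) ** B"
    by (metis B matrix_mul_assoc matrix_mul_rid)
  then show ?thesis
    using is_pinv_pinv[of W] B by (simp add: is_pinv_def)
qed

text \<open>The right-hand side is a two-sided inverse of the square matrix
  \<open>W ** transpose W\<close>, so the Penrose conditions are immediate and uniqueness identifies
  it.\<close>

lemma gram_pinv_eq:
  fixes W :: "real^'q^'n"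
  assumes "rank W = CARD('n)"
  shows "gram_pinv W = transpose (pinv W) ** pinv W"
proof -
  let ?P = "pinv W"
  have WP: "W ** ?P = mat 1" using assms by (rule pinv_right_inverse)
  \<comment> \<open>The left side is the transpose of \<open>?P ** W\<close>, which is
    symmetric.\<close>
  have PW: "transpose W ** transpose ?P = ?P ** W"
    using is_pinv_pinv[of W] by (simp add: is_pinv_def matrix_transpose_mul)
  have "(W ** transpose W) ** (transpose ?P ** ?P) = W ** (transpose W ** transpose ?P) ** ?P"
    by (simp add: matrix_mul_assoc)
  also have "\<dots> = (W ** ?P) ** (W ** ?P)"
    by (simp add: PW matrix_mul_assoc)
  finally have 1: "(W ** transpose W) ** (transpose ?P ** ?P) = mat 1"
    by (simp add: WP)
  then have 2: "(transpose ?P ** ?P) ** (W ** transpose W) = mat 1"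
    by (simp add: matrix_left_right_inverse)
  have "is_pinv (W ** transpose W) (transpose ?P ** ?P)"
    unfolding is_pinv_def 1 2 by simp
  then show ?thesis
    unfolding gram_pinv_def using is_pinv_pinv is_pinv_unique by blast
qed

lemma axis_inner_mult_axis: "axis i 1 \<bullet> (A *v axis i 1) = A $ i $ i"
  for A :: "real^'n^'n"
  by (simp add: inner_axis' matrix_vector_mult_basis column_def)

text \<open>Factoring \<open>gram_pinv W\<close> moves one copy of \<open>pinv W\<close> across the
  inner product.\<close>

lemma gram_pinv_diagonal:
  fixes W :: "real^'q^'n"
  assumes "rank W = CARD('n)"
  shows "gram_pinv W $ i $ i = (norm (pinv W *v axis i 1))\<^sup>2"
proof -
  have "gram_pinv W $ i $ i = axis i 1 \<bullet> (gram_pinv W *v axis i 1)"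
    by (simp add: axis_inner_mult_axis)
  also have "\<dots> = (pinv W *v axis i 1) \<bullet> (pinv W *v axis i 1)"
    by (simp add: gram_pinv_eq[OF assms] flip: matrix_vector_mul_assoc)
      (simp add: dot_lmul_matrix flip: vector_transpose_matrix)
  finally show ?thesis by (simp add: power2_norm_eq_inner)
qed

text \<open>\<open>W\<close> sends \<open>pinv W *v axis i 1\<close> back to a basis vector, so that
  vector is nonzero. Hence the division in \<open>W_tilde\<close> is genuine and
  \<open>diag_part (gram_pinv W)\<close> is invertible.\<close>

lemma gram_pinv_diagonal_pos:
  fixes W :: "real^'q^'n"
  assumes "rank W = CARD('n)"
  shows "gram_pinv W $ i $ i > 0"
proof -
  have "W *v (pinv W *v axis i 1) = axis i 1"
    by (simp add: matrix_vector_mul_assoc pinv_right_inverse[OF assms])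
  then have "pinv W *v axis i 1 \<noteq> 0"
    by (metis axis_eq_0_iff matrix_vector_mult_0_right zero_neq_one)
  then show ?thesis
    by (simp add: gram_pinv_diagonal[OF assms])
qed

lemma outer_mult_vec: "outer u v *v x = (v \<bullet> x) *\<^sub>R u"
  by (simp add: vec_eq_iff outer_def matrix_vector_mult_def inner_vec_def sum_distrib_left
      sum_distrib_right mult_ac)

text \<open>With \<open>v = pinv W *v axis i 1\<close>, the rank-one term of \<open>W_tilde\<close>
  is \<open>v\<close> times its transpose, divided by the squared norm of \<open>v\<close>. The
  bracket is thus the orthogonal projection off the line of \<open>v\<close>, and it kills
  \<open>v\<close>.\<close>

lemma W_tilde_mult_axis:
  fixes W :: "real^'q^'n"
  assumes "rank W = CARD('n)"
  shows "W_tilde W i *v axis i 1 = 0"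
proof -
  let ?v = "pinv W *v axis i 1"
  have c: "axis i 1 \<bullet> (transpose (pinv W) *v ?v) = gram_pinv W $ i $ i"
    by (simp add: matrix_vector_mul_assoc axis_inner_mult_axis gram_pinv_eq[OF assms])
  have "(pinv W ** outer (axis i 1) (axis i 1) ** transpose (pinv W)) *v ?v
      = pinv W *v (outer (axis i 1) (axis i 1) *v (transpose (pinv W) *v ?v))"
    by (simp only: matrix_vector_mul_assoc matrix_mul_assoc)
  also have "\<dots> = gram_pinv W $ i $ i *\<^sub>R ?v"
    by (simp only: outer_mult_vec c matrix_vector_mult_scaleR)
  finally have proj: "(pinv W ** outer (axis i 1) (axis i 1) ** transpose (pinv W)) *v ?v
      = gram_pinv W $ i $ i *\<^sub>R ?v" .
  show ?thesis
    unfolding W_tilde_def axis_inner_mult_axis matrix_vector_mul_assoc[symmetric]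
    using gram_pinv_diagonal_pos[OF assms, of i]
    by (simp add: matrix_vector_mult_diff_rdistrib scaleR_matrix_vector_assoc[symmetric]
        proj del: transpose_matrix_vector)
qed

lemma matrix_inv_diag_part_mult_vec:
  fixes A :: "real^'n^'n"
  assumes "\<And>j. A $ j $ j \<noteq> 0"
  shows "(matrix_inv (diag_part A) *v x) $ i = x $ i / A $ i $ i"
proof -
  let ?D = "diag_part A" and ?E = "(\<chi> j k. if j = k then 1 / A $ j $ j else 0) :: real^'n^'n"
  have mul: "?D *v z = (\<chi> j. A $ j $ j * z $ j)" for z
    by (simp add: vec_eq_iff diag_part_def matrix_vector_mult_def if_distrib[where f = "\<lambda>a. a * _"]
        sum.delta cong: if_cong)
  have right: "?D ** ?E = mat 1"
    using assms
    by (simp add: vec_eq_iff diag_part_def matrix_matrix_mult_def mat_def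
        if_distrib[where f = "\<lambda>a. a * _"] cong: if_cong)
  moreover have "?E ** ?D = mat 1"
    using right by (simp only: matrix_left_right_inverse)
  \<comment> \<open>\<open>matrix_inv\<close> is a choice operator: its inverse property is
    available only once some inverse is exhibited.\<close>
  ultimately have "\<exists>E. ?D ** E = mat 1 \<and> E ** ?D = mat 1"
    by blast
  then have "?D ** matrix_inv ?D = mat 1"
    unfolding matrix_inv_def by (rule someI_ex[THEN conjunct1])
  then have "?D *v (matrix_inv ?D *v x) = x"
    by (simp add: matrix_vector_mul_assoc)
  then have "A $ i $ i * (matrix_inv ?D *v x) $ i = x $ i"
    by (simp add: mul vec_eq_iff)
  then show ?thesis
    using assms[of i] by (simp add: field_simps)
qed

text \<open>Pairing the row with \<open>axis i 1\<close> removes \<open>H_loo\<close>, leaving a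
  diagonal entry of \<open>gram_pinv W\<close> divided by itself.\<close>

lemma partial_row_diagonal:
  fixes W :: "real^'q^'n"
  assumes "rank W = CARD('n)"
  shows "partial_row W T i $ i = 1"
proof -
  let ?G = "gram_pinv W"
  have H: "H_loo W T i *v axis i 1 = 0"
    unfolding H_loo_def
    by (simp add: W_tilde_mult_axis[OF assms] flip: matrix_vector_mul_assoc)
  have "partial_row W T i $ i = partial_row W T i \<bullet> axis i 1"
    by (simp add: inner_axis)
  also have "\<dots> = (matrix_inv (diag_part ?G) *v (?G *v ((mat 1 - H_loo W T i) *v axis i 1))) $ i"
    by (simp add: partial_row_def dot_lmul_matrix inner_axis' matrix_vector_mul_assoc
        matrix_mul_assoc)
  also have "\<dots> = (?G *v axis i 1) $ i / ?G $ i $ i"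
    using gram_pinv_diagonal_pos[OF assms]
    by (subst matrix_inv_diag_part_mult_vec)
      (simp_all add: less_imp_neq[symmetric] matrix_vector_mult_diff_rdistrib H)
  also have "\<dots> = 1"
    using gram_pinv_diagonal_pos[OF assms, of i]
    by (simp add: matrix_vector_mult_basis column_def)
  finally show ?thesis .
qed

lemma partial_norm_sum_pos:
  fixes W :: "real^'q^'n"
  assumes "rank W = CARD('n)"
  shows "partial_norm_sum W T > 0"
  unfolding partial_norm_sum_def
proof (rule sum_pos)
  fix i :: 'n
  have "partial_row W T i \<noteq> 0"
    using partial_row_diagonal[OF assms, of T i] by auto
  then show "(norm (partial_row W T i))\<^sup>2 > 0" by simp
qed auto

lemma norm_eps_partial_square:
  "(norm (eps_partial W T y))\<^sup>2 = (\<Sum>i\<in>UNIV. (partial_row W T i \<bullet> y)\<^sup>2)"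
  unfolding power2_norm_eq_inner by (simp add: eps_partial_def inner_vec_def power2_eq_square)

text \<open>The map is multiplication by the matrix with rows \<open>partial_row W T i\<close>;
  boundedness lets it commute with expectation.\<close>

lemma bounded_linear_eps_partial: "bounded_linear (eps_partial W T)"
proof -
  have "eps_partial W T = (*v) (\<chi> i. partial_row W T i)"
    by (simp add: fun_eq_iff vec_eq_iff eps_partial_def matrix_vector_mult_def inner_vec_def)
  then show ?thesis
    using matrix_vector_mul_bounded_linear by metis
qed

context prob_space
begin

text \<open>On a probability space the constant 1 is integrable, so \<open>1 + t\<^sup>2\<close> is
  an integrable bound for \<open>t\<close>, the norm.\<close>

lemma integrable_of_integrable_norm_square:
  fixes \<epsilon> :: "'a \<Rightarrow> 'b::{banach, second_countable_topology}"
  assumes "\<epsilon> \<in> borel_measurable M" "integrable M (\<lambda>\<omega>. (norm (\<epsilon> \<omega>))\<^sup>2)"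
  shows "integrable M \<epsilon>"
proof (rule Bochner_Integration.integrable_bound)
  show "integrable M (\<lambda>\<omega>. 1 + (norm (\<epsilon> \<omega>))\<^sup>2)"
    using assms(2) by simp
  have "t \<le> 1 + t\<^sup>2" for t :: real
    using zero_le_power2[of "t - 1"] zero_le_power2[of t]
    unfolding power2_diff by (simp; linarith)
  then show "AE \<omega> in M. norm (\<epsilon> \<omega>) \<le> norm (1 + (norm (\<epsilon> \<omega>))\<^sup>2)"
    by simp
qed (rule assms(1))

text \<open>After expanding the square, the cross term vanishes by the zero mean and the covariance
  reduces the quadratic form to its diagonal.\<close>

lemma expectation_square_affine:
  fixes \<epsilon> :: "'a \<Rightarrow> real^'n"
  assumes meas: "\<epsilon> \<in> borel_measurable M"
    and sq: "integrable M (\<lambda>\<omega>. (norm (\<epsilon> \<omega>))\<^sup>2)"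
    and mean: "expectation \<epsilon> = 0"
    and cov: "cov_matrix M \<epsilon> = \<sigma>\<^sup>2 *\<^sub>R mat 1"
  shows "integrable M (\<lambda>\<omega>. (a + r \<bullet> \<epsilon> \<omega>)\<^sup>2)" (is ?int)
    and "expectation (\<lambda>\<omega>. (a + r \<bullet> \<epsilon> \<omega>)\<^sup>2) = a\<^sup>2 + \<sigma>\<^sup>2 * (norm r)\<^sup>2" (is ?exp)
proof -
  have int: "integrable M \<epsilon>"
    using meas sq by (rule integrable_of_integrable_norm_square)
  \<comment> \<open>Each coordinate is at most the norm, so products are dominated by the squared
    norm. This licenses exchanging expectation with the double sum below.\<close>
  have prod: "integrable M (\<lambda>\<omega>. \<epsilon> \<omega> $ j * \<epsilon> \<omega> $ k)" for j k
  proof (rule Bochner_Integration.integrable_bound[OF sq])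
    show "(\<lambda>\<omega>. \<epsilon> \<omega> $ j * \<epsilon> \<omega> $ k) \<in> borel_measurable M"
      using int by (intro borel_measurable_times borel_measurable_integrable
          integrable_bounded_linear[OF bounded_linear_vec_nth])
    have "\<bar>x $ j\<bar> * \<bar>x $ k\<bar> \<le> (norm x)\<^sup>2" for x :: "real^'n"
      unfolding power2_eq_square
      by (intro mult_mono component_le_norm_cart) auto
    then show "AE \<omega> in M. norm (\<epsilon> \<omega> $ j * \<epsilon> \<omega> $ k) \<le> norm ((norm (\<epsilon> \<omega>))\<^sup>2)"
      by (simp add: abs_mult)
  qed
  \<comment> \<open>Zero mean removes the centring in \<open>cov_matrix\<close>, so its entries are
    raw second moments.\<close>
  have second: "expectation (\<lambda>\<omega>. \<epsilon> \<omega> $ j * \<epsilon> \<omega> $ k) = (if j = k then \<sigma>\<^sup>2 else 0)" for j k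
    using arg_cong[OF cov, of "\<lambda>A. A $ j $ k"] mean by (simp add: cov_matrix_def mat_def)
  have lin: "integrable M (\<lambda>\<omega>. r \<bullet> \<epsilon> \<omega>)" "expectation (\<lambda>\<omega>. r \<bullet> \<epsilon> \<omega>) = 0"
    using int mean by simp_all
  have expand: "(r \<bullet> x)\<^sup>2 = (\<Sum>j\<in>UNIV. \<Sum>k\<in>UNIV. r $ j * r $ k * (x $ j * x $ k))" for x
    by (simp add: power2_eq_square inner_vec_def sum_product mult_ac)
  have quad: "integrable M (\<lambda>\<omega>. (r \<bullet> \<epsilon> \<omega>)\<^sup>2)"
    unfolding expand using prod by simp
  have "expectation (\<lambda>\<omega>. (r \<bullet> \<epsilon> \<omega>)\<^sup>2)
      = (\<Sum>j\<in>UNIV. \<Sum>k\<in>UNIV. r $ j * r $ k * (if j = k then \<sigma>\<^sup>2 else 0))"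
    unfolding expand using prod by (simp add: second)
  also have "\<dots> = \<sigma>\<^sup>2 * (norm r)\<^sup>2"
    unfolding power2_norm_eq_inner
    by (simp add: inner_vec_def sum_distrib_left mult_ac if_distrib[where f = "\<lambda>a. _ * a"] cong: if_cong)
  finally have quad_exp: "expectation (\<lambda>\<omega>. (r \<bullet> \<epsilon> \<omega>)\<^sup>2) = \<sigma>\<^sup>2 * (norm r)\<^sup>2" .
  have sum: "(a + r \<bullet> x)\<^sup>2 = a\<^sup>2 + (2 * a) * (r \<bullet> x) + (r \<bullet> x)\<^sup>2" for x
    by (simp add: power2_sum)
  show ?int
    unfolding sum using lin quad by simp
  show ?exp
    unfolding sum using lin quad by (simp add: quad_exp prob_space)
qed

end

theorem theorem2:
  fixes W :: "real^'q^'n" and T :: "real^'m^'n" and X :: "real^('q + 'm)^'n"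
    and \<beta> :: "real^('q + 'm)" and \<sigma> :: real
    and M :: "'w measure" and \<epsilon> y :: "'w \<Rightarrow> real^'n"
  assumes X: "X = hcat W T"
    and W: "rank W = CARD('n)" "CARD('n) < CARD('q)"
    and T: "rank T = CARD('m)" "CARD('m) < CARD('n)"
    and M: "prob_space M"
    and \<epsilon>_meas: "\<epsilon> \<in> borel_measurable M"
    and \<epsilon>_sq_int: "integrable M (\<lambda>\<omega>. (norm (\<epsilon> \<omega>))\<^sup>2)"
    and \<epsilon>_mean: "prob_space.expectation M \<epsilon> = 0"
    and \<epsilon>_cov: "cov_matrix M \<epsilon> = \<sigma>\<^sup>2 *\<^sub>R mat 1"
    and y: "\<And>\<omega>. \<omega> \<in> space M \<Longrightarrow> y \<omega> = X *v \<beta> + \<epsilon> \<omega>"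
  shows "integrable M (\<lambda>\<omega>. eps_partial W T (y \<omega>)) \<and>
    integrable M (\<lambda>\<omega>. sigma2_partial W T (y \<omega>)) \<and>
    prob_space.expectation M (\<lambda>\<omega>. sigma2_partial W T (y \<omega>)) =
      \<sigma>\<^sup>2 + (norm (prob_space.expectation M (\<lambda>\<omega>. eps_partial W T (y \<omega>))))\<^sup>2
             / partial_norm_sum W T"
proof -
  interpret prob_space M by (rule M)
  let ?a = "X *v \<beta>" and ?S = "partial_norm_sum W T"
  let ?r = "partial_row W T"
  have S: "?S \<noteq> 0"
    using partial_norm_sum_pos[OF W(1), of T] by simp
  have \<epsilon>_int: "integrable M \<epsilon>"
    using \<epsilon>_meas \<epsilon>_sq_int by (rule integrable_of_integrable_norm_square)
  \<comment> \<open>The model equation for \<open>y\<close> is given only on \<open>space M\<close>,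
    so the computation uses \<open>?a + \<epsilon> \<omega>\<close> and passes to \<open>y\<close>
    at the end.\<close>
  have y_int: "integrable M (\<lambda>\<omega>. ?a + \<epsilon> \<omega>)" and y_exp: "expectation (\<lambda>\<omega>. ?a + \<epsilon> \<omega>) = ?a"
    using \<epsilon>_int \<epsilon>_mean by (simp_all add: prob_space)
  have eps_int: "integrable M (\<lambda>\<omega>. eps_partial W T (?a + \<epsilon> \<omega>))"
    by (rule integrable_bounded_linear[OF bounded_linear_eps_partial y_int])
  have eps_exp: "expectation (\<lambda>\<omega>. eps_partial W T (?a + \<epsilon> \<omega>)) = eps_partial W T ?a"
    using integral_bounded_linear[OF bounded_linear_eps_partial y_int] y_exp by simp
  note affine = expectation_square_affine[OF \<epsilon>_meas \<epsilon>_sq_int \<epsilon>_mean \<epsilon>_cov]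
  \<comment> \<open>Each residual splits into a deterministic bias and a linear noise term, the form
    required by \<open>affine\<close>.\<close>
  have sigma2: "sigma2_partial W T (?a + x) = (\<Sum>i\<in>UNIV. (?r i \<bullet> ?a + ?r i \<bullet> x)\<^sup>2) / ?S" for x
    by (simp add: sigma2_partial_def norm_eps_partial_square inner_add_right)
  have sigma2_int: "integrable M (\<lambda>\<omega>. sigma2_partial W T (?a + \<epsilon> \<omega>))"
    unfolding sigma2 using affine(1) by simp
  have "expectation (\<lambda>\<omega>. sigma2_partial W T (?a + \<epsilon> \<omega>))
      = (\<Sum>i\<in>UNIV. (?r i \<bullet> ?a)\<^sup>2 + \<sigma>\<^sup>2 * (norm (?r i))\<^sup>2) / ?S"
    unfolding sigma2 using affine by simp
  also have "\<dots> = ((norm (eps_partial W T ?a))\<^sup>2 + \<sigma>\<^sup>2 * ?S) / ?S"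
    by (simp add: norm_eps_partial_square partial_norm_sum_def sum.distrib sum_distrib_left)
  also have "\<dots> = \<sigma>\<^sup>2 + (norm (eps_partial W T ?a))\<^sup>2 / ?S"
    using S by (simp add: field_simps)
  finally have sigma2_exp: "expectation (\<lambda>\<omega>. sigma2_partial W T (?a + \<epsilon> \<omega>))
      = \<sigma>\<^sup>2 + (norm (eps_partial W T ?a))\<^sup>2 / ?S" .
  show ?thesis
    \<comment> \<open>Reading \<open>eps_exp\<close> backwards turns the bias vector into the
      expected residual; the congruence rules restrict the rewriting of \<open>y\<close> to
      \<open>space M\<close>.\<close>
    using eps_int sigma2_int sigma2_exp unfolding eps_exp[symmetric]
    by (simp add: y cong: Bochner_Integration.integrable_cong Bochner_Integration.integral_cong)
qed

end
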